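(* Let $k\ge 2$, $j\ge 1$, and let $\Upsilon$ be a set of pairs $(\tau,u)$ with $\tau\in S_j$, $u\in\{0,\dots,k-1\}^j$ and $\mathrm{red}(u)=u$. Let $$N_k^{\Upsilon}(x,p,q,r,t)=\sum_{n\ge0}\frac{t^n}{[n]_{p,q}!}\sum_{(\sigma,w)\in C_k\wr S_n}q^{\mathrm{inv}(\sigma)}p^{\mathrm{coinv}(\sigma)}r^{\|w\|}x^{\Upsilon\text{-nlap}(\sigma,w)},\qquad A_k^{\Upsilon}(p,q,r,t)=\sum_{n\ge0}\frac{t^n}{[n]_{p,q}!}\sum_{\substack{(\sigma,w)\in C_k\wr S_n\\ \Upsilon\text{-mch}(\sigma,w)=0}}q^{\mathrm{inv}(\sigma)}p^{\mathrm{coinv}(\sigma)}r^{\|w\|}.$$ Then $$N_k^{\Upsilon}(x,p,q,r,t)=\frac{A_k^{\Upsilon}(p,q,r,t)}{1-x\left(1+([k]_rt-1)A_k^{\Upsilon}(p,q,r,t)\right)}.$$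
   Context: $C_k\wr S_n$ is identified with the set of pairs $(\sigma,w)$, $\sigma=\sigma_1\cdots\sigma_n\in S_n$, $w=w_1\cdots w_n\in\{0,\dots,k-1\}^n$ (one empty element for $n=0$). For a sequence of distinct integers, $\mathrm{red}$ replaces the $i$-th smallest entry by $i$; for a word of integers, $\mathrm{red}$ replaces the $i$-th smallest distinct value occurring by $i-1$. $(\sigma,w)$ has a $\Upsilon$-bi-match starting at position $i$ ($1\le i\le n-j+1$) if $(\mathrm{red}(\sigma_i\cdots\sigma_{i+j-1}),\mathrm{red}(w_i\cdots w_{i+j-1}))\in\Upsilon$; $\Upsilon\text{-mch}(\sigma,w)$ is the number of such $i$. Two bi-matches starting at $i$ and $i'$ overlap if the position sets $\{i,\dots,i+j-1\}$ and $\{i',\dots,i'+j-1\}$ intersect; $\Upsilon\text{-nlap}(\sigma,w)$ is the maximum number of pairwise non-overlapping $\Upsilon$-bi-matches in $(\sigma,w)$. $\mathrm{inv}(\sigma)=|\{a<b:\sigma_a>\sigma_b\}|$, $\mathrm{coinv}(\sigma)=|\{a<b:\sigma_a<\sigma_b\}|$, $\|w\|=w_1+\cdots+w_n$, $[n]_{p,q}=p^{n-1}+p^{n-2}q+\cdots+q^{n-1}$, $[n]_{p,q}!=[n]_{p,q}\cdots[1]_{p,q}$ ($[0]_{p,q}!=1$), $[k]_r=1+r+\cdots+r^{k-1}$. *)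

theory Defs
  imports
    "HOL-Combinatorics.Multiset_Permutations"
    "HOL-Computational_Algebra.Computational_Algebra"
begin

text \<open>
  Permutations in one-line notation and words are lists; an element of \<open>C\<^sub>k \<wr> S\<^sub>n\<close> is a pair
  \<open>(\<sigma>, w)\<close> of a permutation of \<open>1, \<dots>, n\<close> and a word of length \<open>n\<close> over \<open>0, \<dots>, k - 1\<close>.
\<close>

definition words :: "nat \<Rightarrow> nat \<Rightarrow> nat list set" where
  "words k n = {w. length w = n \<and> set w \<subseteq> {..<k}}"

definition wreath :: "nat \<Rightarrow> nat \<Rightarrow> (nat list \<times> nat list) set" where
  "wreath k n = permutations_of_set {1..n} \<times> words k n"

definition red_perm :: "nat list \<Rightarrow> nat list" where
  "red_perm xs = map (\<lambda>a. card {b \<in> set xs. b \<le> a}) xs"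

definition red_word :: "nat list \<Rightarrow> nat list" where
  "red_word xs = map (\<lambda>a. card {b \<in> set xs. b < a}) xs"

definition factor :: "nat \<Rightarrow> nat \<Rightarrow> 'a list \<Rightarrow> 'a list" where
  "factor j i xs = take j (drop i xs)"

text \<open>
  Positions are counted from \<open>0\<close>, as usual for lists, so the windows of length \<open>j\<close> start at the
  positions \<open>i\<close> with \<open>i + j \<le> n\<close>.
\<close>

definition bimatches ::
  "nat \<Rightarrow> (nat list \<times> nat list) set \<Rightarrow> nat list \<Rightarrow> nat list \<Rightarrow> nat set" where
  "bimatches j \<Upsilon> \<sigma> w =
     {i. i + j \<le> length \<sigma> \<and> (red_perm (factor j i \<sigma>), red_word (factor j i w)) \<in> \<Upsilon>}"

definition mch ::
  "nat \<Rightarrow> (nat list \<times> nat list) set \<Rightarrow> nat list \<Rightarrow> nat list \<Rightarrow> nat" where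
  "mch j \<Upsilon> \<sigma> w = card (bimatches j \<Upsilon> \<sigma> w)"

definition overlap :: "nat \<Rightarrow> nat \<Rightarrow> nat \<Rightarrow> bool" where
  "overlap j i i' \<longleftrightarrow> {i..<i + j} \<inter> {i'..<i' + j} \<noteq> {}"

definition nlap ::
  "nat \<Rightarrow> (nat list \<times> nat list) set \<Rightarrow> nat list \<Rightarrow> nat list \<Rightarrow> nat" where
  "nlap j \<Upsilon> \<sigma> w =
     Max {card S | S. S \<subseteq> bimatches j \<Upsilon> \<sigma> w \<and> pairwise (\<lambda>i i'. \<not> overlap j i i') S}"

definition inv_stat :: "nat list \<Rightarrow> nat" where
  "inv_stat \<sigma> = card {(a, b). a < b \<and> b < length \<sigma> \<and> \<sigma> ! a > \<sigma> ! b}"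

definition coinv_stat :: "nat list \<Rightarrow> nat" where
  "coinv_stat \<sigma> = card {(a, b). a < b \<and> b < length \<sigma> \<and> \<sigma> ! a < \<sigma> ! b}"

definition pq_int :: "'a :: comm_semiring_1 \<Rightarrow> 'a \<Rightarrow> nat \<Rightarrow> 'a" where
  "pq_int p q n = (\<Sum>i<n. p ^ (n - 1 - i) * q ^ i)"

definition pq_fact :: "'a :: comm_semiring_1 \<Rightarrow> 'a \<Rightarrow> nat \<Rightarrow> 'a" where
  "pq_fact p q n = (\<Prod>m = 1..n. pq_int p q m)"

definition r_int :: "'a :: comm_semiring_1 \<Rightarrow> nat \<Rightarrow> 'a" where
  "r_int r k = (\<Sum>i<k. r ^ i)"

text \<open>
  The generating functions are formal power series in \<open>t\<close> whose coefficients lie in a field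
  containing \<open>x\<close>, \<open>p\<close>, \<open>q\<close>, \<open>r\<close>.
\<close>

definition N_gf ::
  "nat \<Rightarrow> nat \<Rightarrow> (nat list \<times> nat list) set \<Rightarrow> 'a :: field \<Rightarrow> 'a \<Rightarrow> 'a \<Rightarrow> 'a \<Rightarrow> 'a fps" where
  "N_gf k j \<Upsilon> x p q r = Abs_fps (\<lambda>n.
     (\<Sum>(\<sigma>, w)\<in>wreath k n.
        q ^ inv_stat \<sigma> * p ^ coinv_stat \<sigma> * r ^ sum_list w * x ^ nlap j \<Upsilon> \<sigma> w)
     / pq_fact p q n)"

definition A_gf ::
  "nat \<Rightarrow> nat \<Rightarrow> (nat list \<times> nat list) set \<Rightarrow> 'a :: field \<Rightarrow> 'a \<Rightarrow> 'a \<Rightarrow> 'a fps" where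
  "A_gf k j \<Upsilon> p q r = Abs_fps (\<lambda>n.
     (\<Sum>(\<sigma>, w)\<in>{(\<sigma>, w) \<in> wreath k n. mch j \<Upsilon> \<sigma> w = 0}.
        q ^ inv_stat \<sigma> * p ^ coinv_stat \<sigma> * r ^ sum_list w)
     / pq_fact p q n)"

text \<open>
  The quotients by \<open>[n]\<^sub>p\<^sub>,\<^sub>q!\<close> are meaningful only where no \<open>[n]\<^sub>p\<^sub>,\<^sub>q\<close> with \<open>n \<ge> 1\<close> vanishes. This
  holds when \<open>p\<close> and \<open>q\<close> are independent indeterminates; with \<open>'a = int poly poly\<close> below,
  \<open>r\<close> and \<open>x\<close> are indeterminates of the coefficient ring.
\<close>

lemma pq_int_indeterminates_nonzero:
  fixes p q :: "'a :: idom poly poly fract"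
  assumes "p = to_fract [:[:0, 1:]:]" and "q = to_fract [:0, 1:]" and "n \<ge> 1"
  shows "pq_int p q n \<noteq> 0"
proof -
  define P Q :: "'a poly poly" where "P = [:[:0, 1:]:]" and "Q = [:0, 1:]"
  have pow: "to_fract (a ^ m) = to_fract a ^ m" for a :: "'a poly poly" and m
    by (induction m) auto
  have sum: "to_fract (sum f {..<m}) = (\<Sum>i<m. to_fract (f i))"
    for f :: "nat \<Rightarrow> 'a poly poly" and m
    by (induction m) auto
  have "pq_int p q n = to_fract (pq_int P Q n)"
    using assms by (simp add: pq_int_def sum pow P_def Q_def)
  moreover obtain m where "n = Suc m"
    using assms(3) by (cases n) auto
  then have "poly (pq_int P Q n) 0 = [:0, 1:] ^ m"
    by (simp add: pq_int_def P_def Q_def poly_sum sum.lessThan_Suc_shift del: sum.lessThan_Suc)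
  then have "poly (pq_int P Q n) 0 \<noteq> 0"
    by simp
  then have "pq_int P Q n \<noteq> 0"
    by (metis poly_0)
  ultimately show ?thesis
    by simp
qed

end

theory Submission
  imports Defs
begin

text \<open>
  The shortest prefix of \<open>(\<sigma>, w)\<close> that contains a bi-match has its only bi-match at its end, and a
  greedy choice shows that \<open>nlap\<close> of \<open>(\<sigma>, w)\<close> is one more than \<open>nlap\<close> of what remains after this
  prefix. Let \<open>E\<close> be the generating function of the elements whose only bi-match is at the end.
  Since dividing by \<open>[n]\<^sub>p\<^sub>,\<^sub>q!\<close> turns concatenation (up to order isomorphism of the pieces) into the
  product of power series, this reads \<open>N = A + x E N\<close>. Appending one letter to a match-free element
  either keeps it match-free or creates a bi-match at the end only, so \<open>[k]\<^sub>r t A = (A - 1) + E\<close>.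
\<close>

section \<open>Order-invariant statistics and products of generating functions\<close>

text \<open>Inversions and coinversions are the cases \<open>(>)\<close> and \<open>(<)\<close>, so
  that everything about them is proved once for a general \<open>R\<close>.\<close>

definition pair_stat :: "(nat \<Rightarrow> nat \<Rightarrow> bool) \<Rightarrow> nat list \<Rightarrow> nat" where
  "pair_stat R \<sigma> = card {(a, b). a < b \<and> b < length \<sigma> \<and> R (\<sigma> ! a) (\<sigma> ! b)}"

definition cross_stat :: "(nat \<Rightarrow> nat \<Rightarrow> bool) \<Rightarrow> nat set \<Rightarrow> nat set \<Rightarrow> nat" where
  "cross_stat R A B = card {(a, b). a \<in> A \<and> b \<in> B \<and> R a b}"

lemma inv_stat_eq_pair_stat: "inv_stat = pair_stat (>)"
  by (simp add: fun_eq_iff inv_stat_def pair_stat_def)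

lemma coinv_stat_eq_pair_stat: "coinv_stat = pair_stat (<)"
  by (simp add: fun_eq_iff coinv_stat_def pair_stat_def)

text \<open>A pair of positions lies in the left piece, in the right piece, or has one entry in
  each. In the mixed case the order of the positions is automatic, and distinctness turns positions
  into values, so that this count depends only on the two sets of values.\<close>

lemma pair_stat_append:
  assumes "distinct (\<sigma> @ \<tau>)"
  shows "pair_stat R (\<sigma> @ \<tau>) = pair_stat R \<sigma> + pair_stat R \<tau> + cross_stat R (set \<sigma>) (set \<tau>)"
proof -
  define m where "m = length \<sigma>"
  define S where "S \<rho> = {(a, b). a < b \<and> b < length \<rho> \<and> R (\<rho> ! a) (\<rho> ! b)}" for \<rho>
  define X where "X = {(a, b). a < length \<sigma> \<and> b < length \<tau> \<and> R (\<sigma> ! a) (\<tau> ! b)}"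
  have fin: "finite (S \<rho>)" for \<rho>
    by (rule finite_subset[of _ "{..<length \<rho>} \<times> {..<length \<rho>}"]) (auto simp: S_def)
  have finX: "finite X"
    by (rule finite_subset[of _ "{..<length \<sigma>} \<times> {..<length \<tau>}"]) (auto simp: X_def)
  let ?f = "map_prod ((+) m) ((+) m)" and ?g = "map_prod id ((+) m)"
  have split: "S (\<sigma> @ \<tau>) = S \<sigma> \<union> ?f ` S \<tau> \<union> ?g ` X" (is "?L = ?R")
  proof
    show "?R \<subseteq> ?L"
      by (auto simp: S_def X_def m_def nth_append)
    show "?L \<subseteq> ?R"
    proof
      fix z assume "z \<in> ?L"
      then obtain a b where z: "z = (a, b)" "a < b" "b < length \<sigma> + length \<tau>"
          "R ((\<sigma> @ \<tau>) ! a) ((\<sigma> @ \<tau>) ! b)"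
        by (auto simp: S_def)
      consider "b < m" | "a \<ge> m" | "a < m" "b \<ge> m" by linarith
      then show "z \<in> ?R"
      proof cases
        case 1
        then show ?thesis using z by (auto simp: S_def m_def nth_append)
      next
        case 2
        then have "(a - m, b - m) \<in> S \<tau>" "z = ?f (a - m, b - m)"
          using z by (auto simp: S_def m_def nth_append)
        then show ?thesis by blast
      next
        case 3
        then have "(a, b - m) \<in> X" "z = ?g (a, b - m)"
          using z by (auto simp: X_def m_def nth_append)
        then show ?thesis by blast
      qed
    qed
  qed
  have "card (S (\<sigma> @ \<tau>)) = card (S \<sigma>) + card (?f ` S \<tau>) + card (?g ` X)"
    unfolding split
    by (subst card_Un_disjoint, use fin finX in \<open>auto simp: S_def X_def m_def\<close>)+
  also have "card (?f ` S \<tau>) = card (S \<tau>)"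
    by (rule card_image) (auto intro!: inj_onI)
  also have "card (?g ` X) = card X"
    by (rule card_image) (auto intro!: inj_onI)
  also have "card X = cross_stat R (set \<sigma>) (set \<tau>)"
  proof -
    have "bij_betw (map_prod ((!) \<sigma>) ((!) \<tau>)) X {(a, b). a \<in> set \<sigma> \<and> b \<in> set \<tau> \<and> R a b}"
      using assms
      by (auto simp: bij_betw_def inj_on_def X_def nth_eq_iff_index_eq in_set_conv_nth image_iff)
    then show ?thesis
      unfolding cross_stat_def by (rule bij_betw_same_card)
  qed
  finally show ?thesis
    by (simp add: S_def pair_stat_def)
qed

lemma pair_stat_map:
  assumes "\<And>a b. a \<in> set \<sigma> \<Longrightarrow> b \<in> set \<sigma> \<Longrightarrow> R (h a) (h b) \<longleftrightarrow> R a b"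
  shows "pair_stat R (map h \<sigma>) = pair_stat R \<sigma>"
  unfolding pair_stat_def using assms
  by (intro arg_cong[where f = card]) auto

section \<open>Weighted sums over the arrangements of a set of values\<close>

definition wt :: "'a :: field \<Rightarrow> 'a \<Rightarrow> 'a \<Rightarrow> nat list \<Rightarrow> nat list \<Rightarrow> 'a" where
  "wt p q r \<sigma> w = q ^ inv_stat \<sigma> * p ^ coinv_stat \<sigma> * r ^ sum_list w"

definition cross_wt :: "'a :: field \<Rightarrow> 'a \<Rightarrow> nat set \<Rightarrow> nat set \<Rightarrow> 'a" where
  "cross_wt p q A B = q ^ cross_stat (>) A B * p ^ cross_stat (<) A B"

text \<open>The pieces of a cut permutation are arrangements of arbitrary finite sets of values,
  hence the generalisation of \<open>wreath\<close> from \<open>{1..n}\<close> to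
  \<open>A\<close>.\<close>

definition pairs :: "nat \<Rightarrow> nat set \<Rightarrow> (nat list \<times> nat list) set" where
  "pairs k A = permutations_of_set A \<times> words k (card A)"

definition wsum ::
  "nat \<Rightarrow> 'a :: field \<Rightarrow> 'a \<Rightarrow> 'a \<Rightarrow> (nat list \<Rightarrow> nat list \<Rightarrow> 'a) \<Rightarrow> nat set \<Rightarrow> 'a" where
  "wsum k p q r F A = (\<Sum>(\<sigma>, w)\<in>pairs k A. wt p q r \<sigma> w * F \<sigma> w)"

text \<open>Expresses that \<open>F\<close> sees only the relative order of the entries of
  \<open>\<sigma>\<close>. Monotone relabelling takes the place of \<open>red_perm\<close>, which
  suits the transfer of sums between sets of values.\<close>

definition order_invariant :: "(nat list \<Rightarrow> nat list \<Rightarrow> 'a) \<Rightarrow> bool" where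
  "order_invariant F \<longleftrightarrow>
     (\<forall>\<sigma> w h. strict_mono_on (set \<sigma>) h \<longrightarrow> length w = length \<sigma> \<longrightarrow> F (map h \<sigma>) w = F \<sigma> w)"

text \<open>Both series of the theorem have this form: \<open>F\<close> is a power of
  \<open>x\<close> for \<open>N_gf\<close> and the indicator of avoidance for
  \<open>A_gf\<close>.\<close>

definition gf ::
  "nat \<Rightarrow> 'a :: field \<Rightarrow> 'a \<Rightarrow> 'a \<Rightarrow> (nat list \<Rightarrow> nat list \<Rightarrow> 'a) \<Rightarrow> 'a fps" where
  "gf k p q r F = Abs_fps (\<lambda>n. wsum k p q r F {1..n} / pq_fact p q n)"

text \<open>The sum over all ways to cut an element in two; it is the operation on statistics that
  becomes the product of series.\<close>

definition conv ::
  "(nat list \<Rightarrow> nat list \<Rightarrow> 'a :: field) \<Rightarrow> (nat list \<Rightarrow> nat list \<Rightarrow> 'a) \<Rightarrow>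
    nat list \<Rightarrow> nat list \<Rightarrow> 'a" where
  "conv F G \<sigma> w = (\<Sum>m\<le>length \<sigma>. F (take m \<sigma>) (take m w) * G (drop m \<sigma>) (drop m w))"

lemma wreath_eq_pairs: "wreath k n = pairs k {1..n}"
  by (simp add: wreath_def pairs_def)

lemma finite_words [simp]: "finite (words k n)"
proof -
  have "words k n = {w. set w \<subseteq> {..<k} \<and> length w = n}"
    by (auto simp: words_def)
  then show ?thesis
    by (simp add: finite_lists_length_eq)
qed

lemma finite_pairs [simp]: "finite (pairs k A)"
  by (simp add: pairs_def)

lemma pairsD:
  assumes "(\<sigma>, w) \<in> pairs k A"
  shows "set \<sigma> = A" "distinct \<sigma>" "length \<sigma> = card A" "length w = card A" "set w \<subseteq> {..<k}"
  using assms by (auto simp: pairs_def permutations_of_set_def words_def distinct_card)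

lemma pairsI:
  assumes "set \<sigma> = A" "distinct \<sigma>" "length w = length \<sigma>" "set w \<subseteq> {..<k}"
  shows "(\<sigma>, w) \<in> pairs k A"
  using assms by (auto simp: pairs_def permutations_of_set_def words_def distinct_card)

lemma wt_append:
  assumes "distinct (\<sigma> @ \<tau>)"
  shows "wt p q r (\<sigma> @ \<tau>) (w @ v) =
    cross_wt p q (set \<sigma>) (set \<tau>) * wt p q r \<sigma> w * wt p q r \<tau> v"
  by (simp add: wt_def cross_wt_def inv_stat_eq_pair_stat coinv_stat_eq_pair_stat
      pair_stat_append[OF assms] power_add)

lemma wt_map:
  assumes "strict_mono_on (set \<sigma>) h"
  shows "wt p q r (map h \<sigma>) w = wt p q r \<sigma> w"
  using assms
  by (auto simp: wt_def inv_stat_eq_pair_stat coinv_stat_eq_pair_stat pair_stat_map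
      strict_mono_on_less)

lemma wt_singleton: "wt p q r [a] w = r ^ sum_list w"
proof -
  have "pair_stat R [a] = 0" for R
    unfolding pair_stat_def card_eq_0_iff by auto
  then show ?thesis
    by (simp add: wt_def inv_stat_eq_pair_stat coinv_stat_eq_pair_stat)
qed

lemma wsum_cong:
  assumes "\<And>\<sigma> w. distinct \<sigma> \<Longrightarrow> set \<sigma> = A \<Longrightarrow> length w = length \<sigma> \<Longrightarrow> F \<sigma> w = G \<sigma> w"
  shows "wsum k p q r F A = wsum k p q r G A"
  unfolding wsum_def
proof (rule sum.cong[OF refl], clarify)
  fix \<sigma> w assume "(\<sigma>, w) \<in> pairs k A"
  from pairsD[OF this] assms[of \<sigma> w] show "wt p q r \<sigma> w * F \<sigma> w = wt p q r \<sigma> w * G \<sigma> w"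
    by simp
qed

text \<open>The increasing bijection from \<open>{1..card A}\<close> to \<open>A\<close> relabels
  the arrangements of one set into those of the other and changes neither the weight nor
  \<open>F\<close>.\<close>

lemma wsum_order_invariant:
  assumes F: "order_invariant F" and A: "finite A"
  shows "wsum k p q r F A = wsum k p q r F {1..card A}"
proof -
  obtain g where g: "bij_betw g {..<card A} A" "strict_mono_on {..<card A} g"
    using ex_bij_betw_strict_mono_card[OF A] by blast
  \<comment> \<open>The bijection \<open>g\<close> is indexed from 0, whereas the values of a
    permutation start at 1.\<close>
  define h where "h i = g (i - 1)" for i
  have mono: "strict_mono_on {1..card A} h"
  proof (rule strict_mono_onI)
    fix a b assume "a \<in> {1..card A}" "b \<in> {1..card A}" "a < b"
    then show "h a < h b"
      unfolding h_def by (intro strict_mono_onD[OF g(2)]) auto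
  qed
  have im: "h ` {1..card A} = A"
  proof -
    have "{..<card A} = (\<lambda>i. i - 1) ` {1..card A}"
    proof (intro equalityI subsetI)
      fix i assume "i \<in> {..<card A}"
      then show "i \<in> (\<lambda>i. i - 1) ` {1..card A}"
        by (intro image_eqI[of _ _ "Suc i"]) auto
    qed auto
    then show ?thesis
      using g(1) by (simp add: bij_betw_def h_def image_image)
  qed
  have inj: "inj_on h {1..card A}"
    using mono by (rule strict_mono_on_imp_inj_on)
  have "pairs k A = map_prod (map h) id ` pairs k {1..card A}"
    using permutations_of_set_image_inj[OF inj] im
    by (simp add: pairs_def map_prod_surj_on)
  moreover have "inj_on (map_prod (map h) id) (pairs k {1..card A})"
  proof (rule inj_onI, clarify)
    fix \<sigma> w \<tau> v assume *: "(\<sigma>, w) \<in> pairs k {1..card A}" "(\<tau>, v) \<in> pairs k {1..card A}"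
      and "map_prod (map h) id (\<sigma>, w) = map_prod (map h) id (\<tau>, v)"
    then have "map h \<sigma> = map h \<tau>" "w = v"
      by auto
    moreover have "inj_on h (set \<sigma> \<union> set \<tau>)"
      using inj pairsD(1)[OF *(1)] pairsD(1)[OF *(2)] by simp
    ultimately show "\<sigma> = \<tau> \<and> w = v"
      by (auto dest: map_inj_on)
  qed
  ultimately have "wsum k p q r F A =
      (\<Sum>(\<sigma>, w)\<in>pairs k {1..card A}. wt p q r (map h \<sigma>) w * F (map h \<sigma>) w)"
    unfolding wsum_def by (simp add: sum.reindex case_prod_unfold)
  also have "\<dots> = wsum k p q r F {1..card A}"
    unfolding wsum_def
  proof (intro sum.cong refl, clarify)
    fix \<sigma> w assume "(\<sigma>, w) \<in> pairs k {1..card A}"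
    from pairsD[OF this] mono F
    show "wt p q r (map h \<sigma>) w * F (map h \<sigma>) w = wt p q r \<sigma> w * F \<sigma> w"
      by (simp add: wt_map order_invariant_def)
  qed
  finally show ?thesis .
qed

section \<open>Shuffles of value sets and (p,q)-binomial coefficients\<close>

text \<open>The (p,q)-binomial coefficient, as a sum over the possible value sets \<open>B\<close>
  of the first \<open>m\<close> letters.\<close>

definition shuffle_sum :: "'a :: field \<Rightarrow> 'a \<Rightarrow> nat \<Rightarrow> nat \<Rightarrow> 'a" where
  "shuffle_sum p q n m = (\<Sum>B | B \<subseteq> {1..n} \<and> card B = m. cross_wt p q B ({1..n} - B))"

lemma set_drop_eq_Diff:
  assumes "distinct xs"
  shows "set (drop m xs) = set xs - set (take m xs)"
proof -
  have "set xs = set (take m xs) \<union> set (drop m xs)"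
    by (metis append_take_drop_id set_append)
  moreover have "set (take m xs) \<inter> set (drop m xs) = {}"
    using assms by (metis append_take_drop_id distinct_append)
  ultimately show ?thesis by blast
qed

text \<open>Once the value set \<open>B\<close> of the first \<open>m\<close> letters is fixed, the
  two pieces are independent arrangements of \<open>B\<close> and of its complement, and the weight
  of their interaction depends on \<open>B\<close> alone. Order invariance then makes both inner
  sums independent of \<open>B\<close>.\<close>

lemma wsum_split:
  assumes F: "order_invariant F" and G: "order_invariant G" and m: "m \<le> n"
  shows "wsum k p q r (\<lambda>\<sigma> w. F (take m \<sigma>) (take m w) * G (drop m \<sigma>) (drop m w)) {1..n} =
    shuffle_sum p q n m * wsum k p q r F {1..m} * wsum k p q r G {1..n - m}"
proof -
  define A where "A = {1..n}"
  define I where "I = {B. B \<subseteq> A \<and> card B = m}"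
  have finA: "finite A" and cardA: "card A = n"
    by (auto simp: A_def)
  have finI: "finite I"
    using finA by (auto simp: I_def)
  have "wsum k p q r (\<lambda>\<sigma> w. F (take m \<sigma>) (take m w) * G (drop m \<sigma>) (drop m w)) A =
    (\<Sum>(B, (\<sigma>, w), (\<tau>, v))\<in>Sigma I (\<lambda>B. pairs k B \<times> pairs k (A - B)).
       cross_wt p q B (A - B) * (wt p q r \<sigma> w * F \<sigma> w) * (wt p q r \<tau> v * G \<tau> v))"
    unfolding wsum_def
  \<comment> \<open>Cutting after \<open>m\<close> letters and gluing are inverse to each other
    (goals 1 and 3), map into the right sets (goals 2 and 4) and respect the summands (goal
    5).\<close>
  proof (rule sum.reindex_bij_witness[where
        j = "\<lambda>(\<sigma>, w). (set (take m \<sigma>), (take m \<sigma>, take m w), (drop m \<sigma>, drop m w))" and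
        i = "\<lambda>(B, (\<sigma>, w), (\<tau>, v)). (\<sigma> @ \<tau>, w @ v)"], goal_cases)
    case (1 a)
    then show ?case by (auto split: prod.splits)
  next
    case (2 a)
    obtain \<sigma> w where a: "a = (\<sigma>, w)" by force
    have *: "set \<sigma> = A" "distinct \<sigma>" "length \<sigma> = n" "length w = n" "set w \<subseteq> {..<k}"
      using pairsD[of \<sigma> w k A] 2 a cardA by auto
    have B: "set (drop m \<sigma>) = A - set (take m \<sigma>)"
      using set_drop_eq_Diff[of \<sigma> m] * by simp
    have "set (take m \<sigma>) \<in> I"
      using * m set_take_subset[of m \<sigma>] by (auto simp: I_def distinct_card)
    moreover have "(take m \<sigma>, take m w) \<in> pairs k (set (take m \<sigma>))"
      using * set_take_subset[of m w] by (intro pairsI) auto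
    moreover have "(drop m \<sigma>, drop m w) \<in> pairs k (A - set (take m \<sigma>))"
      using * B set_drop_subset[of m w] by (intro pairsI) auto
    ultimately show ?case by (simp add: a)
  next
    case (3 b)
    obtain B \<sigma> w \<tau> v where b: "b = (B, (\<sigma>, w), (\<tau>, v))" by (metis surj_pair)
    show ?case
      using 3 pairsD[of \<sigma> w k B] pairsD[of \<tau> v k "A - B"] by (auto simp: b I_def)
  next
    case (4 b)
    obtain B \<sigma> w \<tau> v where b: "b = (B, (\<sigma>, w), (\<tau>, v))" by (metis surj_pair)
    show ?case
      using 4 pairsD[of \<sigma> w k B] pairsD[of \<tau> v k "A - B"]
      by (auto simp: b I_def intro!: pairsI)
  next
    case (5 a)
    obtain \<sigma> w where a: "a = (\<sigma>, w)" by force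
    have *: "set \<sigma> = A" "distinct \<sigma>"
      using pairsD[of \<sigma> w k A] 5 a by auto
    have B: "set (drop m \<sigma>) = A - set (take m \<sigma>)"
      using set_drop_eq_Diff[of \<sigma> m] * by simp
    show ?case
      using wt_append[of "take m \<sigma>" "drop m \<sigma>" p q r "take m w" "drop m w"] *
      by (simp add: a B)
  qed
  also have "\<dots> = (\<Sum>B\<in>I. \<Sum>y\<in>pairs k B. \<Sum>z\<in>pairs k (A - B).
       cross_wt p q B (A - B) * (case y of (\<sigma>, w) \<Rightarrow> wt p q r \<sigma> w * F \<sigma> w) *
         (case z of (\<tau>, v) \<Rightarrow> wt p q r \<tau> v * G \<tau> v))"
    using finI by (simp add: sum.Sigma sum.cartesian_product case_prod_unfold)
  also have "\<dots> = (\<Sum>B\<in>I. cross_wt p q B (A - B) * wsum k p q r F B * wsum k p q r G (A - B))"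
    by (simp add: wsum_def sum_product mult.assoc flip: sum_distrib_left)
  also have "\<dots> = (\<Sum>B\<in>I. cross_wt p q B (A - B) * wsum k p q r F {1..m} * wsum k p q r G {1..n - m})"
  proof (rule sum.cong[OF refl])
    fix B assume "B \<in> I"
    then have B: "B \<subseteq> A" "card B = m" "finite B" "card (A - B) = n - m"
      using finA cardA by (auto simp: I_def card_Diff_subset finite_subset)
    then show "cross_wt p q B (A - B) * wsum k p q r F B * wsum k p q r G (A - B) =
        cross_wt p q B (A - B) * wsum k p q r F {1..m} * wsum k p q r G {1..n - m}"
      using wsum_order_invariant[OF F B(3), of k p q r]
        wsum_order_invariant[OF G, of "A - B" k p q r] finA by simp
  qed
  also have "\<dots> = shuffle_sum p q n m * wsum k p q r F {1..m} * wsum k p q r G {1..n - m}"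
    by (simp add: shuffle_sum_def I_def A_def sum_distrib_right)
  finally show ?thesis
    by (simp add: A_def)
qed

text \<open>Here \<open>B\<close> misses a single value, that of the last letter. If it is
  \<open>Suc n - i\<close>, then \<open>i\<close> larger and \<open>n - i\<close> smaller values
  precede it, which gives the term with exponents \<open>n - i\<close> of \<open>p\<close> and
  \<open>i\<close> of \<open>q\<close>.\<close>

lemma shuffle_sum_last: "shuffle_sum p q (Suc n) n = pq_int p q (Suc n)"
proof -
  let ?B = "\<lambda>i. {1..Suc n} - {Suc n - i}"
  have compl: "{1..Suc n} - ?B i = {Suc n - i}" if "i < Suc n" for i
    using that by auto
  have "{B. B \<subseteq> {1..Suc n} \<and> card B = n} = ?B ` {..<Suc n}"
  proof (intro equalityI subsetI)
    fix B assume B: "B \<in> {B. B \<subseteq> {1..Suc n} \<and> card B = n}"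
    then have "card ({1..Suc n} - B) = 1"
      by (subst card_Diff_subset) (auto intro: finite_subset)
    then obtain b where b: "{1..Suc n} - B = {b}"
      by (auto simp: card_1_singleton_iff)
    then have "b \<in> {1..Suc n}" "B = {1..Suc n} - {b}"
      using B by blast+
    then have "B = ?B (Suc n - b)" "Suc n - b \<in> {..<Suc n}"
      by auto
    then show "B \<in> ?B ` {..<Suc n}"
      by (rule image_eqI)
  next
    fix B assume "B \<in> ?B ` {..<Suc n}"
    then obtain i where i: "i < Suc n" "B = ?B i"
      by auto
    then have "card B = n"
      by (subst i(2), subst card_Diff_singleton) auto
    then show "B \<in> {B. B \<subseteq> {1..Suc n} \<and> card B = n}"
      using i by auto
  qed
  moreover have "inj_on ?B {..<Suc n}"
  proof (rule inj_onI)
    fix a b assume ab: "a \<in> {..<Suc n}" "b \<in> {..<Suc n}" "?B a = ?B b"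
    then have "{Suc n - a} = {Suc n - b}"
      using compl[of a] compl[of b] by (metis lessThan_iff)
    then show "a = b" using ab(1,2) by auto
  qed
  ultimately have "shuffle_sum p q (Suc n) n =
      (\<Sum>i<Suc n. cross_wt p q (?B i) {Suc n - i})"
    unfolding shuffle_sum_def
    by (simp only: sum.reindex o_def) (intro sum.cong refl, simp only: compl lessThan_iff)
  also have "\<dots> = pq_int p q (Suc n)"
    unfolding pq_int_def
  proof (rule sum.cong[OF refl])
    fix i assume i: "i \<in> {..<Suc n}"
    let ?b = "Suc n - i"
    have "{(a, b). a \<in> {1..Suc n} - {?b} \<and> b \<in> {?b} \<and> a > b} = {Suc ?b..Suc n} \<times> {?b}"
      "{(a, b). a \<in> {1..Suc n} - {?b} \<and> b \<in> {?b} \<and> a < b} = {1..<?b} \<times> {?b}"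
      using i by auto
    then show "cross_wt p q ({1..Suc n} - {?b}) {?b} = p ^ (Suc n - 1 - i) * q ^ i"
      using i by (simp add: cross_wt_def cross_stat_def card_cartesian_product mult.commute)
  qed
  finally show ?thesis .
qed

lemma words_Suc_0: "words (Suc 0) n = {replicate n 0}"
  by (auto simp: words_def lessThan_Suc subset_iff intro!: replicate_eqI)

text \<open>With one colour the word is all zeros and has weight 1, so this is the joint
  distribution of \<open>inv_stat\<close> and \<open>coinv_stat\<close> on permutations. Splitting
  off the last letter contributes one factor \<open>pq_int\<close> at a time.\<close>

lemma wsum_one_colour: "wsum 1 p q r (\<lambda>_ _. 1) {1..n} = pq_fact p q n"
proof (induction n)
  case 0
  show ?case
    by (simp add: wsum_def pairs_def words_Suc_0 wt_def inv_stat_def coinv_stat_def pq_fact_def)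
next
  case (Suc n)
  have 1: "wsum 1 p q r (\<lambda>_ _. 1) {1..Suc 0} = 1"
    by (simp add: wsum_def pairs_def words_Suc_0 wt_singleton)
  have "wsum 1 p q r (\<lambda>_ _. 1) {1..Suc n} =
      shuffle_sum p q (Suc n) n * wsum 1 p q r (\<lambda>_ _. 1) {1..n} *
        wsum 1 p q r (\<lambda>_ _. 1) {1..Suc n - n}"
    using wsum_split[of "\<lambda>_ _. 1" "\<lambda>_ _. 1" n "Suc n" 1 p q r]
    by (simp add: order_invariant_def)
  also have "\<dots> = pq_fact p q (Suc n)"
    using Suc.IH 1 by (simp add: shuffle_sum_last pq_fact_def mult.commute)
  finally show ?case .
qed

text \<open>Cutting with constant statistics and one colour turns all three weighted sums into
  (p,q)-factorials. This evaluates the (p,q)-binomial coefficient without division.\<close>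

lemma shuffle_sum_pq_fact:
  assumes "m \<le> n"
  shows "shuffle_sum p q n m * pq_fact p q m * pq_fact p q (n - m) = pq_fact p q n"
  using wsum_split[of "\<lambda>_ _. 1" "\<lambda>_ _. 1" m n 1 p q 1] assms
  by (simp add: order_invariant_def flip: wsum_one_colour[of p q 1])

section \<open>Products, linearity and elementary generating functions\<close>

text \<open>The (p,q)-binomial coefficient that appears for each cut is exactly what the division by
  (p,q)-factorials absorbs, so a Cauchy product remains.\<close>

lemma gf_conv:
  assumes nz: "\<And>n. n \<ge> 1 \<Longrightarrow> pq_int p q n \<noteq> 0"
    and F: "order_invariant F" and G: "order_invariant G"
  shows "gf k p q r (conv F G) = gf k p q r F * gf k p q r G"
proof (rule fps_ext)
  fix n
  have nz': "pq_fact p q m \<noteq> 0" for m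
    using nz by (auto simp: pq_fact_def)
  define H where "H m \<sigma> w = F (take m \<sigma>) (take m w) * G (drop m \<sigma>) (drop m w)" for m \<sigma> w
  \<comment> \<open>Every \<open>\<sigma>\<close> has length \<open>n\<close> here, so the range of
    the cut points no longer depends on \<open>\<sigma>\<close> and the sums can be
    interchanged.\<close>
  have "wsum k p q r (conv F G) {1..n} = wsum k p q r (\<lambda>\<sigma> w. \<Sum>m\<le>n. H m \<sigma> w) {1..n}"
    by (rule wsum_cong) (auto simp: conv_def H_def dest!: distinct_card)
  also have "\<dots> = (\<Sum>m\<le>n. wsum k p q r (H m) {1..n})"
    unfolding wsum_def
    by (simp add: sum_distrib_left case_prod_unfold) (rule sum.swap)
  also have "\<dots> / pq_fact p q n =
      (\<Sum>m\<le>n. (wsum k p q r F {1..m} / pq_fact p q m) *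
        (wsum k p q r G {1..n - m} / pq_fact p q (n - m)))"
    unfolding sum_divide_distrib
  proof (rule sum.cong[OF refl])
    fix m assume "m \<in> {..n}"
    then have m: "m \<le> n" by simp
    have "wsum k p q r (H m) {1..n} =
        shuffle_sum p q n m * wsum k p q r F {1..m} * wsum k p q r G {1..n - m}"
      unfolding H_def by (rule wsum_split[OF F G m])
    moreover have "pq_fact p q n = shuffle_sum p q n m * pq_fact p q m * pq_fact p q (n - m)"
      using shuffle_sum_pq_fact[OF m, of p q] by simp
    \<comment> \<open>It is a factor of the nonzero \<open>pq_fact p q n\<close>.\<close>
    moreover from this have "shuffle_sum p q n m \<noteq> 0"
      using nz'[of n] by auto
    ultimately show "wsum k p q r (H m) {1..n} / pq_fact p q n =
        (wsum k p q r F {1..m} / pq_fact p q m) *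
          (wsum k p q r G {1..n - m} / pq_fact p q (n - m))"
      using nz' by simp
  qed
  finally show "gf k p q r (conv F G) $ n = (gf k p q r F * gf k p q r G) $ n"
    by (simp add: gf_def fps_mult_nth atLeast0AtMost)
qed

lemma gf_cong:
  assumes "\<And>\<sigma> w. distinct \<sigma> \<Longrightarrow> length w = length \<sigma> \<Longrightarrow> F \<sigma> w = G \<sigma> w"
  shows "gf k p q r F = gf k p q r G"
  unfolding gf_def by (intro arg_cong[where f = Abs_fps] ext arg_cong2[where f = divide]
      wsum_cong assms refl)

lemma gf_add: "gf k p q r (\<lambda>\<sigma> w. F \<sigma> w + G \<sigma> w) = gf k p q r F + gf k p q r G"
  by (rule fps_ext)
     (simp add: gf_def wsum_def case_prod_unfold distrib_left sum.distrib add_divide_distrib)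

lemma gf_mult_const: "gf k p q r (\<lambda>\<sigma> w. c * F \<sigma> w) = fps_const c * gf k p q r F"
  by (rule fps_ext)
     (simp add: gf_def wsum_def case_prod_unfold sum_distrib_left mult.left_commute)

lemma gf_empty: "gf k p q r (\<lambda>\<sigma> w. of_bool (\<sigma> = [])) = 1"
proof (rule fps_ext)
  fix n
  have "words k 0 = {[]}" by (auto simp: words_def)
  then have "wsum k p q r (\<lambda>\<sigma> w. of_bool (\<sigma> = [])) {1..0} = 1"
    by (simp add: wsum_def pairs_def wt_def inv_stat_def coinv_stat_def)
  moreover have "wsum k p q r (\<lambda>\<sigma> w. of_bool (\<sigma> = [])) {1..n} = 0" if "n > 0"
    unfolding wsum_def using that by (auto intro!: sum.neutral dest!: pairsD(3))
  ultimately have "wsum k p q r (\<lambda>\<sigma> w. of_bool (\<sigma> = [])) {1..n} = of_bool (n = 0)"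
    by (cases "n = 0") auto
  then show "gf k p q r (\<lambda>\<sigma> w. of_bool (\<sigma> = [])) $ n = 1 $ n"
    by (simp add: gf_def pq_fact_def)
qed

text \<open>A single letter may carry each of the \<open>k\<close> colours. Multiplication by this
  series stands for appending one letter.\<close>

lemma gf_letter:
  "gf k p q r (\<lambda>\<sigma> w. of_bool (length \<sigma> = 1)) = fps_const (r_int r k) * fps_X"
proof (rule fps_ext)
  fix n
  have W: "words k (Suc 0) = (\<lambda>i. [i]) ` {..<k}"
    by (auto simp: words_def length_Suc_conv)
  have "wsum k p q r (\<lambda>\<sigma> w. of_bool (length \<sigma> = 1)) {1..n} = of_bool (n = 1) * r_int r k"
  proof (cases "n = 1")
    case True
    have "wsum k p q r (\<lambda>\<sigma> w. of_bool (length \<sigma> = 1)) {1..n} =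
        (\<Sum>w\<in>words k (Suc 0). wt p q r [1] w)"
      using True by (simp add: wsum_def pairs_def flip: sum.cartesian_product)
    also have "\<dots> = r_int r k"
      unfolding W
      by (subst sum.reindex)
         (auto simp: wt_singleton r_int_def inj_on_def)
    finally show ?thesis using True by simp
  next
    case False
    then show ?thesis
      unfolding wsum_def by (auto intro!: sum.neutral dest!: pairsD(3))
  qed
  then show "gf k p q r (\<lambda>\<sigma> w. of_bool (length \<sigma> = 1)) $ n =
      (fps_const (r_int r k) * fps_X) $ n"
    by (cases "n = 1") (auto simp: gf_def pq_fact_def pq_int_def)
qed

section \<open>The greedy decomposition\<close>

text \<open>The statistic \<open>nlap\<close> depends only on the set of starting positions, so the
  greedy argument can be made for an arbitrary finite set of naturals.\<close>

definition packing :: "nat \<Rightarrow> nat set \<Rightarrow> nat" where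
  "packing j M = Max {card S | S. S \<subseteq> M \<and> pairwise (\<lambda>i i'. \<not> overlap j i i') S}"

lemma overlap_iff: "j \<ge> 1 \<Longrightarrow> overlap j i i' \<longleftrightarrow> i < i' + j \<and> i' < i + j"
proof -
  assume j: "j \<ge> 1"
  \<comment> \<open>The later of the two starting positions serves as the common position.\<close>
  have "max i i' \<in> {i..<i + j} \<inter> {i'..<i' + j}" if "i < i' + j \<and> i' < i + j"
    using that j by auto
  then show ?thesis
    unfolding overlap_def by fastforce
qed

lemma packing_empty: "packing j {} = 0"
proof -
  have "{card S | S. S \<subseteq> ({} :: nat set) \<and> pairwise (\<lambda>i i'. \<not> overlap j i i') S} = {0}"
    by (auto intro!: exI[of _ "{}"])
  then show ?thesis by (simp add: packing_def)
qed

lemma finite_packings: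
  assumes "finite M"
  shows "finite {card S | S. S \<subseteq> M \<and> P S}"
  by (rule finite_subset[of _ "card ` Pow M"]) (use assms in auto)

lemma card_le_packing:
  assumes "finite M" "S \<subseteq> M" "pairwise (\<lambda>i i'. \<not> overlap j i i') S"
  shows "card S \<le> packing j M"
  unfolding packing_def
  by (rule Max_ge) (use assms finite_packings[OF assms(1)] in auto)

lemma packing_attained:
  assumes "finite M"
  obtains S where "S \<subseteq> M" "pairwise (\<lambda>i i'. \<not> overlap j i i') S" "card S = packing j M"
proof -
  have "packing j M \<in> {card S | S. S \<subseteq> M \<and> pairwise (\<lambda>i i'. \<not> overlap j i i') S}"
    unfolding packing_def
    by (rule Max_in[OF finite_packings[OF assms]]) (auto intro!: exI[of _ "{}"])
  then show ?thesis using that by auto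
qed

text \<open>An exchange argument. In an optimal packing all windows but the first start at or after
  \<open>Min M + j\<close>, so dropping the first one leaves a packing of the shifted set.
  Conversely, the window at \<open>Min M\<close> can be put in front of every packing of the shifted
  set.\<close>

lemma packing_greedy:
  assumes M: "finite M" "M \<noteq> {}" and j: "j \<ge> 1"
  shows "packing j M = Suc (packing j {i. i + (Min M + j) \<in> M})"
proof -
  define i0 where "i0 = Min M"
  define M' where "M' = {i. i + (i0 + j) \<in> M}"
  have i0: "i0 \<in> M" "\<And>i. i \<in> M \<Longrightarrow> i0 \<le> i"
    using M by (auto simp: i0_def)
  have finM': "finite M'"
    using finite_vimageI[OF M(1), of "\<lambda>i. i + (i0 + j)"]
    by (simp add: M'_def vimage_def)
  note ov = overlap_iff[OF j]
  show ?thesis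
    unfolding i0_def[symmetric] M'_def[symmetric]
  proof (rule antisym)
    obtain S where S: "S \<subseteq> M" "pairwise (\<lambda>i i'. \<not> overlap j i i') S" "card S = packing j M"
      using packing_attained[OF M(1)] by blast
    have finS: "finite S" using S(1) M(1) finite_subset by blast
    show "packing j M \<le> Suc (packing j M')"
    proof (cases "S = {}")
      case True
      then show ?thesis using S(3) by simp
    next
      case False
      define s where "s = Min S"
      have s: "s \<in> S" "\<And>i. i \<in> S \<Longrightarrow> s \<le> i"
        using False finS by (auto simp: s_def)
      \<comment> \<open>Windows after \<open>s\<close> that avoid it start at \<open>s + j\<close>
        or later, and \<open>s\<close> is at least \<open>i0\<close>.\<close>
      have far: "i0 + j \<le> i" if "i \<in> S - {s}" for i
      proof -
        have "\<not> overlap j s i" using S(2) s(1) that by (auto simp: pairwise_def)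
        moreover have "s \<le> i" "i0 \<le> s" using s i0 S(1) that by auto
        ultimately show ?thesis using j by (auto simp: ov)
      qed
      \<comment> \<open>By \<open>far\<close> the subtraction is never truncated.\<close>
      define S' where "S' = (\<lambda>i. i - (i0 + j)) ` (S - {s})"
      have "card S' = card (S - {s})"
        unfolding S'_def using far by (intro card_image inj_onI) (metis le_add_diff_inverse)
      moreover have "S' \<subseteq> M'"
        using far S(1) by (auto simp: S'_def M'_def)
      moreover have "pairwise (\<lambda>i i'. \<not> overlap j i i') S'"
      proof (rule pairwiseI)
        fix c d assume "c \<in> S'" "d \<in> S'" "c \<noteq> d"
        then obtain a b where ab: "a \<in> S - {s}" "b \<in> S - {s}" "a \<noteq> b"
            "c = a - (i0 + j)" "d = b - (i0 + j)"
          by (auto simp: S'_def)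
        then have "\<not> overlap j a b" using S(2) by (auto simp: pairwise_def)
        with ab far[of a] far[of b] show "\<not> overlap j c d" by (auto simp: ov)
      qed
      ultimately have "card (S - {s}) \<le> packing j M'"
        using card_le_packing[OF finM'] by metis
      then show ?thesis using s(1) finS S(3) by simp
    qed
  next
    obtain S where S: "S \<subseteq> M'" "pairwise (\<lambda>i i'. \<not> overlap j i i') S" "card S = packing j M'"
      using packing_attained[OF finM'] by blast
    define T where "T = (\<lambda>i. i + (i0 + j)) ` S"
    have finS: "finite S" using S(1) finM' finite_subset by blast
    have T: "i0 \<notin> T" "finite T" "card T = card S"
      using j finS by (auto simp: T_def card_image)
    have "insert i0 T \<subseteq> M"
      using S(1) i0(1) by (auto simp: T_def M'_def)
    moreover have "pairwise (\<lambda>i i'. \<not> overlap j i i') (insert i0 T)"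
      using S(2) by (fastforce simp: pairwise_def T_def ov)
    ultimately have "card (insert i0 T) \<le> packing j M"
      using card_le_packing[OF M(1)] by metis
    then show "Suc (packing j M') \<le> packing j M"
      using T S(3) by simp
  qed
qed

section \<open>Bi-matches under cutting and relabelling\<close>

lemma nlap_eq_packing: "nlap j \<Upsilon> \<sigma> w = packing j (bimatches j \<Upsilon> \<sigma> w)"
  by (simp add: nlap_def packing_def)

lemma finite_bimatches: "finite (bimatches j \<Upsilon> \<sigma> w)"
  by (rule finite_subset[of _ "{..length \<sigma>}"]) (auto simp: bimatches_def)

lemma mch_eq_0_iff: "mch j \<Upsilon> \<sigma> w = 0 \<longleftrightarrow> bimatches j \<Upsilon> \<sigma> w = {}"
  by (simp add: mch_def finite_bimatches)

lemma bimatches_take: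
  assumes "m \<le> length \<sigma>"
  shows "bimatches j \<Upsilon> (take m \<sigma>) (take m w) = {i \<in> bimatches j \<Upsilon> \<sigma> w. i + j \<le> m}"
  using assms by (auto simp: bimatches_def factor_def drop_take min_def)

lemma bimatches_drop:
  assumes "m \<le> length \<sigma>"
  shows "bimatches j \<Upsilon> (drop m \<sigma>) (drop m w) = {i. i + m \<in> bimatches j \<Upsilon> \<sigma> w}"
  using assms by (auto simp: bimatches_def factor_def)

text \<open>Each entry is replaced by its rank, and \<open>h\<close> carries the entries up to
  \<open>a\<close> bijectively onto those up to \<open>h a\<close>.\<close>

lemma red_perm_map:
  assumes "strict_mono_on (set xs) h"
  shows "red_perm (map h xs) = red_perm xs"
proof -
  have "card {b \<in> h ` set xs. b \<le> h a} = card {b \<in> set xs. b \<le> a}" if "a \<in> set xs" for a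
  proof -
    have "{b \<in> h ` set xs. b \<le> h a} = h ` {b \<in> set xs. b \<le> a}"
      using assms that by (auto simp: strict_mono_on_less_eq)
    moreover have "inj_on h {b \<in> set xs. b \<le> a}"
      using strict_mono_on_imp_inj_on[OF assms] by (rule inj_on_subset) auto
    ultimately show ?thesis by (simp add: card_image)
  qed
  then show ?thesis by (simp add: red_perm_def)
qed

lemma bimatches_map:
  assumes "strict_mono_on (set \<sigma>) h"
  shows "bimatches j \<Upsilon> (map h \<sigma>) w = bimatches j \<Upsilon> \<sigma> w"
proof -
  have "red_perm (factor j i (map h \<sigma>)) = red_perm (factor j i \<sigma>)" for i
  proof -
    have "set (factor j i \<sigma>) \<subseteq> set \<sigma>"
      unfolding factor_def by (meson set_drop_subset set_take_subset subset_trans)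
    then have "strict_mono_on (set (factor j i \<sigma>)) h"
      using assms by (auto simp: strict_mono_on_def)
    then show ?thesis
      using red_perm_map[of "factor j i \<sigma>" h] by (simp add: factor_def take_map drop_map)
  qed
  then show ?thesis by (simp add: bimatches_def)
qed

section \<open>Pointwise forms of the two recurrences\<close>

definition avoids ::
  "nat \<Rightarrow> (nat list \<times> nat list) set \<Rightarrow> nat list \<Rightarrow> nat list \<Rightarrow> bool" where
  "avoids j \<Upsilon> \<sigma> w \<longleftrightarrow> bimatches j \<Upsilon> \<sigma> w = {}"

text \<open>If \<open>\<sigma>\<close> is shorter than \<open>j\<close>, the truncated difference is
  0, but no window fits and the predicate is false.\<close>

definition end_match ::
  "nat \<Rightarrow> (nat list \<times> nat list) set \<Rightarrow> nat list \<Rightarrow> nat list \<Rightarrow> bool" where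
  "end_match j \<Upsilon> \<sigma> w \<longleftrightarrow> bimatches j \<Upsilon> \<sigma> w = {length \<sigma> - j}"

lemma conv_letter:
  "conv F (\<lambda>\<sigma> w. of_bool (length \<sigma> = 1)) \<sigma> w =
    (if \<sigma> = [] then 0 else F (take (length \<sigma> - 1) \<sigma>) (take (length \<sigma> - 1) w))"
proof (cases "\<sigma> = []")
  case False
  then have "length \<sigma> - m = 1 \<longleftrightarrow> m = length \<sigma> - 1" if "m \<le> length \<sigma>" for m
    using that by (cases \<sigma>) auto
  then have "conv F (\<lambda>\<sigma> w. of_bool (length \<sigma> = 1)) \<sigma> w =
      (\<Sum>m\<le>length \<sigma>. if m = length \<sigma> - 1 then F (take m \<sigma>) (take m w) else 0)"
    unfolding conv_def by (intro sum.cong) auto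
  then show ?thesis using False by simp
qed (simp add: conv_def)

text \<open>Deleting the last letter destroys only the window that ends there. So the shortened
  element is match-free exactly when the whole one has no bi-match or just the final one; these
  cases exclude each other, and their indicators add up. The empty element has no letter to delete
  and is counted separately.\<close>

lemma append_letter:
  assumes "j \<ge> 1"
  shows "(of_bool (avoids j \<Upsilon> \<sigma> w) :: 'a :: field) + of_bool (end_match j \<Upsilon> \<sigma> w) =
    of_bool (\<sigma> = []) +
      conv (\<lambda>\<sigma> w. of_bool (avoids j \<Upsilon> \<sigma> w)) (\<lambda>\<sigma> w. of_bool (length \<sigma> = 1)) \<sigma> w"
proof (cases "\<sigma> = []")
  case True
  then show ?thesis
    using assms unfolding conv_letter by (simp add: avoids_def end_match_def bimatches_def)
next
  case False
  let ?M = "bimatches j \<Upsilon> \<sigma> w" and ?n = "length \<sigma>"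
  have le: "i + j \<le> ?n" if "i \<in> ?M" for i
    using that by (auto simp: bimatches_def)
  have "{i \<in> ?M. i + j \<le> ?n - 1} = {} \<longleftrightarrow> ?M = {} \<or> ?M = {?n - j}"
    (is "?l \<longleftrightarrow> ?r")
  proof
    assume ?l
    then have "\<not> i + j \<le> ?n - 1" if "i \<in> ?M" for i
      using that by blast
    \<comment> \<open>The window fits into length \<open>?n\<close> but not into
      \<open>?n - 1\<close>, so it ends at the last letter.\<close>
    then have "i = ?n - j" if "i \<in> ?M" for i
      using le[OF that] that by fastforce
    then show ?r by blast
  next
    assume ?r
    moreover have "\<not> i + j \<le> ?n - 1" if "i \<in> ?M" "?M = {?n - j}" for i
    proof -
      have "?n > 0" using False by simp
      moreover have "i = ?n - j" using that by auto
      ultimately show ?thesis by linarith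
    qed
    ultimately show ?l by blast
  qed
  moreover have "avoids j \<Upsilon> (take (?n - 1) \<sigma>) (take (?n - 1) w) \<longleftrightarrow>
      {i \<in> ?M. i + j \<le> ?n - 1} = {}"
    unfolding avoids_def by (subst bimatches_take) auto
  ultimately have "avoids j \<Upsilon> (take (?n - 1) \<sigma>) (take (?n - 1) w) \<longleftrightarrow>
      avoids j \<Upsilon> \<sigma> w \<or> end_match j \<Upsilon> \<sigma> w"
    by (simp only: avoids_def end_match_def)
  moreover have "\<not> (avoids j \<Upsilon> \<sigma> w \<and> end_match j \<Upsilon> \<sigma> w)"
    by (auto simp: avoids_def end_match_def)
  ultimately show ?thesis
    unfolding conv_letter using False by auto
qed

text \<open>If there is a bi-match, exactly one cut has a prefix whose only bi-match is at its end,
  namely the cut right after the first bi-match. There \<open>packing_greedy\<close> accounts for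
  the factor \<open>x\<close> and for the remaining suffix. Without bi-matches the convolution
  vanishes.\<close>

lemma power_nlap:
  fixes x :: "'a :: field"
  assumes "j \<ge> 1"
  shows "x ^ nlap j \<Upsilon> \<sigma> w =
    of_bool (avoids j \<Upsilon> \<sigma> w) +
      x * conv (\<lambda>\<sigma> w. of_bool (end_match j \<Upsilon> \<sigma> w)) (\<lambda>\<sigma> w. x ^ nlap j \<Upsilon> \<sigma> w) \<sigma> w"
proof -
  let ?M = "bimatches j \<Upsilon> \<sigma> w" and ?n = "length \<sigma>"
  have end_take: "end_match j \<Upsilon> (take m \<sigma>) (take m w) \<longleftrightarrow> {i \<in> ?M. i + j \<le> m} = {m - j}"
    if "m \<le> ?n" for m
    using that by (simp add: end_match_def bimatches_take)
  show ?thesis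
  proof (cases "?M = {}")
    case True
    then have "conv (\<lambda>\<sigma> w. of_bool (end_match j \<Upsilon> \<sigma> w)) (\<lambda>\<sigma> w. x ^ nlap j \<Upsilon> \<sigma> w) \<sigma> w = 0"
      unfolding conv_def by (intro sum.neutral) (auto simp: end_take)
    then show ?thesis
      using True by (simp add: avoids_def nlap_eq_packing packing_empty)
  next
    case False
    define m0 where "m0 = Min ?M + j"
    have min: "Min ?M \<in> ?M" "\<And>i. i \<in> ?M \<Longrightarrow> Min ?M \<le> i"
      using False finite_bimatches by auto
    have m0: "m0 \<le> ?n"
      using min(1) by (auto simp: bimatches_def m0_def)
    have "{i \<in> ?M. i + j \<le> m} = {m - j} \<longleftrightarrow> m = m0" for m
    proof
      assume *: "{i \<in> ?M. i + j \<le> m} = {m - j}"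
      then have "m - j \<in> ?M" "m - j + j \<le> m" by auto
      \<comment> \<open>The first bi-match ends no later than the one at \<open>m - j\<close>, so it
        lies in the same prefix and must coincide with its only bi-match.\<close>
      then have "Min ?M \<in> {i \<in> ?M. i + j \<le> m}" using min(2)[of "m - j"] min(1) by auto
      with * have "Min ?M = m - j" by auto
      then show "m = m0" using \<open>m - j + j \<le> m\<close> by (simp add: m0_def)
    next
      assume "m = m0"
      then show "{i \<in> ?M. i + j \<le> m} = {m - j}"
        using min by (force simp: m0_def)
    qed
    then have "conv (\<lambda>\<sigma> w. of_bool (end_match j \<Upsilon> \<sigma> w)) (\<lambda>\<sigma> w. x ^ nlap j \<Upsilon> \<sigma> w) \<sigma> w =
        (\<Sum>m\<le>?n. if m = m0 then x ^ nlap j \<Upsilon> (drop m \<sigma>) (drop m w) else 0)"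
      unfolding conv_def by (intro sum.cong) (auto simp: end_take)
    also have "\<dots> = x ^ nlap j \<Upsilon> (drop m0 \<sigma>) (drop m0 w)"
      using m0 by simp
    finally show ?thesis
      \<comment> \<open>The bi-matches of the suffix after \<open>m0\<close> are precisely the
        shifted set in \<open>packing_greedy\<close>.\<close>
      using False packing_greedy[OF finite_bimatches False assms]
      by (simp add: avoids_def nlap_eq_packing bimatches_drop[OF m0] flip: m0_def)
  qed
qed

section \<open>The functional equations and their solution\<close>

lemma N_gf_eq_gf: "N_gf k j \<Upsilon> x p q r = gf k p q r (\<lambda>\<sigma> w. x ^ nlap j \<Upsilon> \<sigma> w)"
  by (simp add: N_gf_def gf_def wsum_def wreath_eq_pairs wt_def)

lemma A_gf_eq_gf: "A_gf k j \<Upsilon> p q r = gf k p q r (\<lambda>\<sigma> w. of_bool (avoids j \<Upsilon> \<sigma> w))"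
proof -
  have "(\<Sum>(\<sigma>, w)\<in>{(\<sigma>, w) \<in> wreath k n. mch j \<Upsilon> \<sigma> w = 0}.
        q ^ inv_stat \<sigma> * p ^ coinv_stat \<sigma> * r ^ sum_list w) =
      wsum k p q r (\<lambda>\<sigma> w. of_bool (avoids j \<Upsilon> \<sigma> w)) {1..n}" for n
    unfolding wsum_def wreath_eq_pairs
    by (rule sum.mono_neutral_cong_left) (auto simp: wt_def avoids_def mch_eq_0_iff)
  then show ?thesis
    by (simp add: A_gf_def gf_def)
qed

theorem theorem10:
  fixes k j :: nat
    and \<Upsilon> :: "(nat list \<times> nat list) set"
    and x p q r :: "'a :: field"
  assumes "k \<ge> 2" and "j \<ge> 1"
    and "\<And>\<tau> u. (\<tau>, u) \<in> \<Upsilon> \<Longrightarrow>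
           \<tau> \<in> permutations_of_set {1..j} \<and> u \<in> words k j \<and> red_word u = u"
    and "\<And>n. n \<ge> 1 \<Longrightarrow> pq_int p q n \<noteq> 0"
  shows "N_gf k j \<Upsilon> x p q r =
    A_gf k j \<Upsilon> p q r /
      (1 - fps_const x * (1 + (fps_const (r_int r k) * fps_X - 1) * A_gf k j \<Upsilon> p q r))"
proof -
  define A where "A = A_gf k j \<Upsilon> p q r"
  define N where "N = N_gf k j \<Upsilon> x p q r"
  define E where "E = gf k p q r (\<lambda>\<sigma> w. of_bool (end_match j \<Upsilon> \<sigma> w))"
  \<comment> \<open>Each of these depends on \<open>\<sigma>\<close> only through its bi-matches or
    its length, and relabelling preserves both.\<close>
  have inv:
    "order_invariant (\<lambda>\<sigma> w. of_bool (avoids j \<Upsilon> \<sigma> w) :: 'a)"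
    "order_invariant (\<lambda>\<sigma> w. of_bool (end_match j \<Upsilon> \<sigma> w) :: 'a)"
    "order_invariant (\<lambda>\<sigma> w. x ^ nlap j \<Upsilon> \<sigma> w)"
    "order_invariant (\<lambda>\<sigma> w :: nat list. of_bool (length \<sigma> = 1) :: 'a)"
    by (simp_all add: order_invariant_def avoids_def end_match_def nlap_eq_packing bimatches_map)
  have gf_conv': "gf k p q r (conv F G) = gf k p q r F * gf k p q r G"
    if "order_invariant F" "order_invariant G" for F G
    using gf_conv assms(4) that by blast
  have "A + E = gf k p q r (\<lambda>\<sigma> w. of_bool (\<sigma> = []) +
      conv (\<lambda>\<sigma> w. of_bool (avoids j \<Upsilon> \<sigma> w)) (\<lambda>\<sigma> w. of_bool (length \<sigma> = 1)) \<sigma> w)"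
    unfolding A_def E_def A_gf_eq_gf gf_add[symmetric] append_letter[OF assms(2)] by (rule refl)
  also have "\<dots> = 1 + A * (fps_const (r_int r k) * fps_X)"
    unfolding gf_add gf_empty gf_conv'[OF inv(1,4)] gf_letter A_def A_gf_eq_gf
    by (rule refl)
  finally have E: "E = 1 + (fps_const (r_int r k) * fps_X - 1) * A"
    by (simp add: algebra_simps)
  have "N = gf k p q r (\<lambda>\<sigma> w. of_bool (avoids j \<Upsilon> \<sigma> w) +
      x * conv (\<lambda>\<sigma> w. of_bool (end_match j \<Upsilon> \<sigma> w)) (\<lambda>\<sigma> w. x ^ nlap j \<Upsilon> \<sigma> w) \<sigma> w)"
    unfolding N_def N_gf_eq_gf by (rule gf_cong) (rule power_nlap[OF assms(2)])
  also have "\<dots> = A + fps_const x * (E * N)"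
    by (simp add: gf_add gf_mult_const gf_conv'[OF inv(2,3)] A_def E_def N_def
        N_gf_eq_gf A_gf_eq_gf)
  finally have "A = N * (1 - fps_const x * E)"
    by (simp add: algebra_simps)
  \<comment> \<open>The empty element has no window of length \<open>j \<ge> 1\<close>. Hence the
    denominator has constant term 1, and the division is legitimate.\<close>
  moreover have "E $ 0 = 0"
    using assms(2)
    by (auto simp: E_def gf_def wsum_def pairs_def end_match_def bimatches_def
        intro!: sum.neutral)
  then have "1 - fps_const x * E \<noteq> 0"
    by (auto simp: fps_eq_iff intro!: exI[of _ 0])
  ultimately have "N = A / (1 - fps_const x * E)"
    by simp
  then show ?thesis
    by (simp add: E A_def N_def)
qed

end
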